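(* Let $T$ be a propositional theory over $\mathcal V$, let $(\mathcal A,\oplus,\otimes,e^\oplus,e^\otimes)$ be a commutative semiring, and let $\alpha:\mathcal L\to\mathcal A$ be a labeling function on the literals of $\mathcal V$. Assume that $\otimes$ is idempotent ($a\otimes a=a$ for all $a\in\mathcal A$) and that $(\otimes,\alpha)$ is consistency-preserving, i.e. $\alpha(v)\otimes\alpha(\neg v)=e^\oplus$ for all $v\in\mathcal V$. Let $N_T$ be an NNF circuit over $\mathcal V$ logically equivalent to $T$. Then evaluating $N_T$ is a sound AMC computation, i.e. $$\mathrm{Eval}(N_T,\oplus,\otimes,e^\oplus,e^\otimes,\alpha)=\mathbf A(T),$$ in each of the following cases: \begin{itemize} \item $N_T$ is an s-NNF (smooth) whose set of variables is $\mathcal V$, and $\oplus$ is idempotent ($a\oplus a=a$ for all $a\in\mathcal A$); \item $N_T$ is a d-NNF (deterministic), and $(\oplus,\alpha)$ is neutral, i.e. $\alpha(v)\oplus\alpha(\neg v)=e^\otimes$ for all $v\in\mathcal V$; \item $N_T$ is an arbitrary NNF, $\oplus$ is idempotent, and $(\oplus,\alpha)$ is neutral. \end{itemize}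
   Context: A semiring $(\mathcal A,\oplus,\otimes,e^\oplus,e^\otimes)$ has associative binary operations $\oplus,\otimes$ on $\mathcal A$, with $\oplus$ commutative, $\otimes$ distributing over $\oplus$, $e^\oplus$ neutral for $\oplus$, $e^\otimes$ neutral for $\otimes$, and $e^\oplus\otimes a=a\otimes e^\oplus=e^\oplus$ for all $a$. It is commutative if $\otimes$ is also commutative. Algebraic model count: for a propositional theory $T$ over a finite set $\mathcal V$ of variables and $\alpha:\mathcal L\to\mathcal A$ on the set $\mathcal L$ of literals of $\mathcal V$, $$\mathbf A(T)=\bigoplus_{I\in\mathcal M(T)}\ \bigotimes_{l\in I}\alpha(l),$$ where $\mathcal M(T)$ is the set of models of $T$; a model is a set of literals containing exactly one of $v,\neg v$ for each $v\in\mathcal V$. Empty sums are $e^\oplus$, empty products $e^\otimes$. An NNF circuit over $\mathcal V$ is a finite rooted directed acyclic graph whose leaves are labeled with $\top$, $\bot$ or a literal of a variable in $\mathcal V$, and whose internal nodes are labeled $\vee$ or $\wedge$. Each node is identified with the formula of the subcircuit rooted at it, and its variables are those occurring in that subcircuit. The circuit is deterministic if for each disjunction node $\bigvee_{i=1}^n\phi_i$ each two children $\phi_i,\phi_j$ ($i\ne j$) are logically inconsistent; smooth if for each disjunction node all children mention the same set of variables. $\mathrm{Eval}$ is defined recursively from the leaves to the root: $\top\mapsto e^\otimes$, $\bot\mapsto e^\oplus$, literal $l\mapsto\alpha(l)$, a disjunction node $\mapsto$ the $\oplus$-sum of the values of its children, a conjunction node $\mapsto$ the $\otimes$-product of the values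 of its children; the value of the circuit is that of its root. *)

theory Defs
  imports Main
begin

section \<open>Literals, interpretations and propositional theories\<close>

datatype 'v literal = Pos 'v | Neg 'v

primrec var_of :: "'v literal \<Rightarrow> 'v" where
  "var_of (Pos v) = v"
| "var_of (Neg v) = v"

definition literals :: "'v set \<Rightarrow> 'v literal set" where
  "literals V = {l. var_of l \<in> V}"

definition interpretations :: "'v set \<Rightarrow> 'v literal set set" where
  "interpretations V = {I. I \<subseteq> literals V \<and> (\<forall>v\<in>V. (Pos v \<in> I) \<noteq> (Neg v \<in> I))}"

datatype 'v formula =
  FTrue | FFalse | FVar 'v | FNot "'v formula"
| FAnd "'v formula" "'v formula" | FOr "'v formula" "'v formula"
| FImp "'v formula" "'v formula" | FIff "'v formula" "'v formula"

primrec formula_vars :: "'v formula \<Rightarrow> 'v set" where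
  "formula_vars FTrue = {}"
| "formula_vars FFalse = {}"
| "formula_vars (FVar v) = {v}"
| "formula_vars (FNot \<phi>) = formula_vars \<phi>"
| "formula_vars (FAnd \<phi> \<psi>) = formula_vars \<phi> \<union> formula_vars \<psi>"
| "formula_vars (FOr \<phi> \<psi>) = formula_vars \<phi> \<union> formula_vars \<psi>"
| "formula_vars (FImp \<phi> \<psi>) = formula_vars \<phi> \<union> formula_vars \<psi>"
| "formula_vars (FIff \<phi> \<psi>) = formula_vars \<phi> \<union> formula_vars \<psi>"

primrec formula_sat :: "'v literal set \<Rightarrow> 'v formula \<Rightarrow> bool" where
  "formula_sat I FTrue \<longleftrightarrow> True"
| "formula_sat I FFalse \<longleftrightarrow> False"
| "formula_sat I (FVar v) \<longleftrightarrow> Pos v \<in> I"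
| "formula_sat I (FNot \<phi>) \<longleftrightarrow> \<not> formula_sat I \<phi>"
| "formula_sat I (FAnd \<phi> \<psi>) \<longleftrightarrow> formula_sat I \<phi> \<and> formula_sat I \<psi>"
| "formula_sat I (FOr \<phi> \<psi>) \<longleftrightarrow> formula_sat I \<phi> \<or> formula_sat I \<psi>"
| "formula_sat I (FImp \<phi> \<psi>) \<longleftrightarrow> (formula_sat I \<phi> \<longrightarrow> formula_sat I \<psi>)"
| "formula_sat I (FIff \<phi> \<psi>) \<longleftrightarrow> (formula_sat I \<phi> \<longleftrightarrow> formula_sat I \<psi>)"

type_synonym 'v prop_theory = "'v formula set"

definition theory_over :: "'v set \<Rightarrow> 'v prop_theory \<Rightarrow> bool" where
  "theory_over V T \<longleftrightarrow> (\<forall>\<phi>\<in>T. formula_vars \<phi> \<subseteq> V)"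

definition models :: "'v set \<Rightarrow> 'v prop_theory \<Rightarrow> 'v literal set set" where
  "models V T = {I \<in> interpretations V. \<forall>\<phi>\<in>T. formula_sat I \<phi>}"


section \<open>Algebraic model counting\<close>

text \<open>
  The sort \<open>{comm_semiring_0, comm_monoid_mult}\<close> is used for commutative semirings, rather than
  \<open>comm_semiring_1\<close>, because the latter also demands \<open>0 \<noteq> 1\<close>.
\<close>

definition amc ::
  "'v set \<Rightarrow> 'v prop_theory \<Rightarrow> ('v literal \<Rightarrow> 'a::{comm_semiring_0, comm_monoid_mult}) \<Rightarrow> 'a" where
  "amc V T \<alpha> = (\<Sum>I\<in>models V T. \<Prod>l\<in>I. \<alpha> l)"

definition consistency_preserving ::
  "'v set \<Rightarrow> ('v literal \<Rightarrow> 'a::{comm_semiring_0, comm_monoid_mult}) \<Rightarrow> bool" where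
  "consistency_preserving V \<alpha> \<longleftrightarrow> (\<forall>v\<in>V. \<alpha> (Pos v) * \<alpha> (Neg v) = 0)"

definition neutral_labeling ::
  "'v set \<Rightarrow> ('v literal \<Rightarrow> 'a::{comm_semiring_0, comm_monoid_mult}) \<Rightarrow> bool" where
  "neutral_labeling V \<alpha> \<longleftrightarrow> (\<forall>v\<in>V. \<alpha> (Pos v) + \<alpha> (Neg v) = 1)"


section \<open>NNF circuits\<close>

datatype 'v node_label = Verum | Falsum | Lit "'v literal" | Disj | Conj

record ('n, 'v) circuit =
  nodes :: "'n set"
  edges :: "('n \<times> 'n) set"  \<comment> \<open>\<open>(n, m)\<close> means that \<open>m\<close> is a child of \<open>n\<close>\<close>
  node_label :: "'n \<Rightarrow> 'v node_label"
  root_node :: 'n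

definition children :: "('n, 'v) circuit \<Rightarrow> 'n \<Rightarrow> 'n set" where
  "children N n = edges N `` {n}"

definition node_vars :: "('n, 'v) circuit \<Rightarrow> 'n \<Rightarrow> 'v set" where
  "node_vars N n = {var_of l |l m. (n, m) \<in> (edges N)\<^sup>* \<and> node_label N m = Lit l}"

locale nnf_circuit =
  fixes V :: "'v set" and N :: "('n, 'v) circuit"
  assumes finite_nodes: "finite (nodes N)"
    and edges_subset: "edges N \<subseteq> nodes N \<times> nodes N"
    and acyclic_edges: "acyclic (edges N)"
    and root_in_nodes: "root_node N \<in> nodes N"
    and reachable: "n \<in> nodes N \<Longrightarrow> (root_node N, n) \<in> (edges N)\<^sup>*"
    and internal_iff: "n \<in> nodes N \<Longrightarrow> node_label N n \<in> {Disj, Conj} \<longleftrightarrow> children N n \<noteq> {}"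
    and literal_over: "n \<in> nodes N \<Longrightarrow> node_label N n = Lit l \<Longrightarrow> l \<in> literals V"
begin

lemma wf_child: "wf ((edges N)\<inverse>)"
  using finite_subset[OF edges_subset] finite_nodes acyclic_edges
  by (simp add: finite_acyclic_wf_converse)

text \<open>Satisfaction of the formula represented by the subcircuit rooted at a node.\<close>

function node_sat :: "'v literal set \<Rightarrow> 'n \<Rightarrow> bool" where
  "node_sat I n =
    (case node_label N n of
       Verum \<Rightarrow> True
     | Falsum \<Rightarrow> False
     | Lit l \<Rightarrow> l \<in> I
     | Disj \<Rightarrow> (\<exists>m\<in>children N n. node_sat I m)
     | Conj \<Rightarrow> (\<forall>m\<in>children N n. node_sat I m))"
  by pat_completeness auto
termination
  by (relation "inv_image ((edges N)\<inverse>) snd") (auto simp: wf_child children_def)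

function node_eval :: "('v literal \<Rightarrow> 'a::{comm_semiring_0, comm_monoid_mult}) \<Rightarrow> 'n \<Rightarrow> 'a" where
  "node_eval \<alpha> n =
    (case node_label N n of
       Verum \<Rightarrow> 1
     | Falsum \<Rightarrow> 0
     | Lit l \<Rightarrow> \<alpha> l
     | Disj \<Rightarrow> (\<Sum>m\<in>children N n. node_eval \<alpha> m)
     | Conj \<Rightarrow> (\<Prod>m\<in>children N n. node_eval \<alpha> m))"
  by pat_completeness auto
termination
  by (relation "inv_image ((edges N)\<inverse>) snd") (auto simp: wf_child children_def)

declare node_sat.simps [simp del] node_eval.simps [simp del]

definition Eval :: "('v literal \<Rightarrow> 'a::{comm_semiring_0, comm_monoid_mult}) \<Rightarrow> 'a" where
  "Eval \<alpha> = node_eval \<alpha> (root_node N)"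

definition equivalent_to :: "'v prop_theory \<Rightarrow> bool" where
  "equivalent_to T \<longleftrightarrow> {I \<in> interpretations V. node_sat I (root_node N)} = models V T"

definition deterministic :: bool where
  "deterministic \<longleftrightarrow>
    (\<forall>n\<in>nodes N. node_label N n = Disj \<longrightarrow>
      (\<forall>m\<in>children N n. \<forall>m'\<in>children N n. m \<noteq> m' \<longrightarrow>
        \<not> (\<exists>I\<in>interpretations V. node_sat I m \<and> node_sat I m')))"

definition smooth :: bool where
  "smooth \<longleftrightarrow>
    (\<forall>n\<in>nodes N. node_label N n = Disj \<longrightarrow>
      (\<forall>m\<in>children N n. \<forall>m'\<in>children N n. node_vars N m = node_vars N m'))"

end

end

theory Submission
  imports Defs
begin

text \<open>
  Write \<open>w(I)\<close> for the product of the labels of an interpretation \<open>I\<close>. Idempotency of multiplication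
  and consistency preservation give \<open>\<alpha> l * w(I) = w(I)\<close> if \<open>l \<in> I\<close>, and \<open>0\<close> otherwise; so, by
  induction over the circuit, multiplying the value of a node by \<open>w(I)\<close> yields \<open>w(I)\<close> or \<open>0\<close>
  according to whether \<open>I\<close> satisfies the node. At a disjunction, several satisfied children
  contribute several copies of \<open>w(I)\<close>, which idempotency of addition or determinism reduces to one.
  Summing over all \<open>I\<close>, the value of the root times the product of all \<open>\<alpha> v + \<alpha> (\<not>v)\<close> is the
  algebraic model count. It remains to drop these factors: they are \<open>1\<close> under neutrality, and in a
  smooth circuit they are absorbed by the value of any node that mentions \<open>v\<close>.
\<close>

section \<open>Absorption in finite products and sums\<close>

lemma prod_idem_absorb:
  fixes f :: "'b \<Rightarrow> 'a::comm_monoid_mult"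
  assumes "finite A" and "x \<in> A" and "f x * f x = f x"
  shows "f x * prod f A = prod f A"
proof -
  have "f x * (f x * prod f (A - {x})) = f x * prod f (A - {x})"
    using assms(3) by (simp flip: mult.assoc)
  then show ?thesis
    by (simp only: prod.remove[OF assms(1,2), of f])
qed

lemma prod_mult_absorb:
  fixes f :: "'b \<Rightarrow> 'a::comm_monoid_mult"
  assumes "finite A" and "x \<in> A" and "f x * c = f x"
  shows "prod f A * c = prod f A"
proof -
  have "f x * prod f (A - {x}) * c = f x * c * prod f (A - {x})"
    by (simp only: ac_simps)
  then show ?thesis
    by (simp only: prod.remove[OF assms(1,2), of f] assms(3))
qed

text \<open>A single copy of \<open>w\<close> passes through the factors one after another, so no
  power of \<open>w\<close> arises; once some factor turns it into \<open>0\<close>, it stays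
  \<open>0\<close>.\<close>

lemma prod_mult_indicator:
  fixes f :: "'b \<Rightarrow> 'a::{comm_semiring_0, comm_monoid_mult}"
  assumes "finite A" and "\<And>m. m \<in> A \<Longrightarrow> f m * w = (if Q m then w else 0)"
  shows "prod f A * w = (if \<forall>m\<in>A. Q m then w else 0)"
  using assms by (induction A) (auto simp: mult.assoc)

text \<open>Either repeated copies of \<open>w\<close> merge, or at most one summand can differ from
  \<open>0\<close>; these are what idempotent addition and determinism supply at a
  disjunction.\<close>

lemma sum_indicator:
  fixes w :: "'a::comm_monoid_add"
  assumes "finite A"
    and "w + w = w \<or> (\<forall>m\<in>A. \<forall>m'\<in>A. m \<noteq> m' \<longrightarrow> \<not> (Q m \<and> Q m'))"
  shows "(\<Sum>m\<in>A. if Q m then w else 0) = (if \<exists>m\<in>A. Q m then w else 0)"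
  using assms(2)
proof
  assume "w + w = w"
  with \<open>finite A\<close> show ?thesis
    by (induction A) auto
next
  assume unique: "\<forall>m\<in>A. \<forall>m'\<in>A. m \<noteq> m' \<longrightarrow> \<not> (Q m \<and> Q m')"
  show ?thesis
  proof (cases "\<exists>m\<in>A. Q m")
    case True
    then obtain m where m: "m \<in> A" "Q m" by blast
    then have "(\<Sum>k\<in>A. if Q k then w else 0) = (\<Sum>k\<in>A. if k = m then w else 0)"
      using unique by (intro sum.cong) auto
    with m \<open>finite A\<close> show ?thesis by auto
  qed simp
qed

section \<open>Interpretations and their total weight\<close>

lemma literals_eq: "literals V = Pos ` V \<union> Neg ` V"
proof (intro set_eqI)
  show "l \<in> literals V \<longleftrightarrow> l \<in> Pos ` V \<union> Neg ` V" for l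
    by (cases l) (auto simp: literals_def)
qed

lemma finite_interpretation:
  "finite V \<Longrightarrow> I \<in> interpretations V \<Longrightarrow> finite I"
  by (auto simp: interpretations_def literals_eq intro: finite_subset)

lemma finite_interpretations: "finite V \<Longrightarrow> finite (interpretations V)"
  by (rule finite_subset[of _ "Pow (literals V)"]) (auto simp: interpretations_def literals_eq)

lemma interpretations_empty: "interpretations {} = {{}}"
  by (auto simp: interpretations_def literals_def)

lemma interpretations_insert:
  assumes "v \<notin> V"
  shows "interpretations (insert v V) =
    insert (Pos v) ` interpretations V \<union> insert (Neg v) ` interpretations V"
proof (intro equalityI subsetI)
  fix I assume I: "I \<in> interpretations (insert v V)"
  \<comment> \<open>Exactly one of the two literals of \<open>v\<close> lies in \<open>I\<close>, so
    adding that one back to \<open>J\<close> recovers \<open>I\<close>.\<close>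
  define J where "J = I - {Pos v, Neg v}"
  have "J \<in> interpretations V"
    using I assms by (auto simp: J_def interpretations_def literals_eq)
  moreover have "I = insert (Pos v) J \<or> I = insert (Neg v) J"
    using I by (auto simp: J_def interpretations_def)
  ultimately show "I \<in> insert (Pos v) ` interpretations V \<union> insert (Neg v) ` interpretations V"
    by blast
qed (use assms in \<open>auto simp: interpretations_def literals_eq\<close>)

text \<open>Expanding the product by distributivity picks one literal per variable, and such choices
  are exactly the interpretations.\<close>

lemma sum_interpretations_prod:
  fixes \<alpha> :: "'v literal \<Rightarrow> 'a::{comm_semiring_0, comm_monoid_mult}"
  assumes "finite V"
  shows "(\<Sum>I\<in>interpretations V. prod \<alpha> I) = (\<Prod>v\<in>V. \<alpha> (Pos v) + \<alpha> (Neg v))"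
  using assms
proof (induction V)
  case empty
  then show ?case by (simp add: interpretations_empty)
next
  case (insert v V)
  have fresh: "Pos v \<notin> I \<and> Neg v \<notin> I" if "I \<in> interpretations V" for I
    using that insert.hyps by (auto simp: interpretations_def literals_eq)
  have step: "(\<Sum>I\<in>insert l ` interpretations V. prod \<alpha> I)
      = \<alpha> l * (\<Sum>I\<in>interpretations V. prod \<alpha> I)" if "l = Pos v \<or> l = Neg v" for l
  proof -
    have "inj_on (insert l) (interpretations V)"
      using fresh that by (intro inj_onI) (metis insert_ident)
    then have "(\<Sum>I\<in>insert l ` interpretations V. prod \<alpha> I)
        = (\<Sum>I\<in>interpretations V. prod \<alpha> (insert l I))"
      by (simp add: sum.reindex)
    also have "\<dots> = (\<Sum>I\<in>interpretations V. \<alpha> l * prod \<alpha> I)"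
      using fresh that insert.hyps by (intro sum.cong) (auto simp: finite_interpretation)
    finally show ?thesis
      by (simp add: sum_distrib_left)
  qed
  have "insert (Pos v) ` interpretations V \<inter> insert (Neg v) ` interpretations V = {}"
    using fresh by fastforce
  with insert show ?case
    by (simp add: interpretations_insert finite_interpretations sum.union_disjoint step
        distrib_right)
qed

section \<open>Evaluation of circuits\<close>

context nnf_circuit
begin

lemma finite_children: "finite (children N n)"
proof -
  have "children N n \<subseteq> nodes N"
    using edges_subset by (auto simp: children_def)
  then show ?thesis
    using finite_nodes by (rule finite_subset)
qed

lemma child_in_nodes: "m \<in> children N n \<Longrightarrow> m \<in> nodes N"
  using edges_subset by (auto simp: children_def)

lemma node_induct [consumes 1, case_names node]:
  assumes "n \<in> nodes N"
    and "\<And>n. n \<in> nodes N \<Longrightarrow> (\<And>m. m \<in> children N n \<Longrightarrow> P m) \<Longrightarrow> P n"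
  shows "P n"
  using assms(1)
proof (induction n rule: wf_induct_rule[OF wf_child])
  case (1 n)
  then show ?case
    using assms(2) child_in_nodes by (auto simp: children_def)
qed

text \<open>A path is empty or starts with an edge to a child. This turns the definition by
  reachability into a recursion that fits \<open>node_induct\<close>.\<close>

lemma node_vars_unfold:
  "node_vars N n = (case node_label N n of Lit l \<Rightarrow> {var_of l} | _ \<Rightarrow> {})
    \<union> (\<Union>m\<in>children N n. node_vars N m)"
proof -
  have "(n, k) \<in> (edges N)\<^sup>* \<longleftrightarrow> k = n \<or> (\<exists>m\<in>children N n. (m, k) \<in> (edges N)\<^sup>*)" for k
    by (auto simp: children_def intro: converse_rtrancl_into_rtrancl elim: converse_rtranclE)
  then show ?thesis
    by (auto simp: node_vars_def split: node_label.splits)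
qed

lemma children_leaf:
  "n \<in> nodes N \<Longrightarrow> node_label N n \<notin> {Disj, Conj} \<Longrightarrow> children N n = {}"
  using internal_iff by blast

lemma node_eval_mult_interpretation:
  fixes \<alpha> :: "'v literal \<Rightarrow> 'a::{comm_semiring_0, comm_monoid_mult}"
  assumes "finite V"
    and idem: "\<And>a::'a. a * a = a"
    and cons: "consistency_preserving V \<alpha>"
    and add: "(\<forall>a::'a. a + a = a) \<or> deterministic"
    and I: "I \<in> interpretations V"
    and "n \<in> nodes N"
  shows "node_eval \<alpha> n * prod \<alpha> I = (if node_sat I n then prod \<alpha> I else 0)"
  using \<open>n \<in> nodes N\<close>
proof (induction rule: node_induct)
  case (node n)
  have fin: "finite I"
    using \<open>finite V\<close> I by (rule finite_interpretation)
  show ?case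
  proof (cases "node_label N n")
    case (Lit l)
    have absorb: "\<alpha> k * prod \<alpha> I = prod \<alpha> I" if "k \<in> I" for k
      using fin that idem by (rule prod_idem_absorb)
    \<comment> \<open>The literal \<open>k\<close> opposite to \<open>l\<close> lies in
      \<open>I\<close>, so the product absorbs an extra \<alpha> \<open>k\<close>, which consistency
      preservation annihilates against \<alpha> \<open>l\<close>.\<close>
    have "\<alpha> l * prod \<alpha> I = 0" if "l \<notin> I"
    proof -
      have "var_of l \<in> V"
        using literal_over[OF node.hyps Lit] by (simp add: literals_def)
      then have "\<alpha> (Pos (var_of l)) * \<alpha> (Neg (var_of l)) = 0"
        and "\<alpha> (Neg (var_of l)) * \<alpha> (Pos (var_of l)) = 0"
        and "Pos (var_of l) \<in> I \<longleftrightarrow> Neg (var_of l) \<notin> I"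
        using I cons
        by (auto simp: interpretations_def consistency_preserving_def mult.commute)
      with that obtain k where k: "k \<in> I" "\<alpha> l * \<alpha> k = 0"
        by (cases l) auto
      then show ?thesis
        using absorb[OF k(1)] by (metis mult.assoc mult_zero_left)
    qed
    with absorb Lit show ?thesis
      by (simp add: node_eval.simps[of _ n] node_sat.simps[of _ n])
  next
    case Disj
    have "prod \<alpha> I + prod \<alpha> I = prod \<alpha> I \<or> (\<forall>m\<in>children N n. \<forall>m'\<in>children N n. m \<noteq> m' \<longrightarrow>
        \<not> (node_sat I m \<and> node_sat I m'))"
      using add Disj node.hyps I by (auto simp: deterministic_def)
    from sum_indicator[OF finite_children this] Disj show ?thesis
      by (simp add: node_eval.simps[of _ n] node_sat.simps[of _ n] sum_distrib_right node.IH)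
  next
    case Conj
    with prod_mult_indicator[OF finite_children node.IH] show ?thesis
      by (simp add: node_eval.simps[of _ n] node_sat.simps[of _ n])
  qed (simp_all add: node_eval.simps[of _ n] node_sat.simps[of _ n])
qed

text \<open>At a literal of \<open>v\<close>, one product is idempotent and the other vanishes.
  Smoothness makes every child of a disjunction mention \<open>v\<close>, so each summand absorbs
  the factor; at a conjunction one such child suffices.\<close>

lemma smooth_node_eval_absorb:
  fixes \<alpha> :: "'v literal \<Rightarrow> 'a::{comm_semiring_0, comm_monoid_mult}"
  assumes idem: "\<And>a::'a. a * a = a"
    and cons: "consistency_preserving V \<alpha>"
    and smooth
    and "n \<in> nodes N"
    and "v \<in> node_vars N n"
  shows "node_eval \<alpha> n * (\<alpha> (Pos v) + \<alpha> (Neg v)) = node_eval \<alpha> n"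
  using \<open>n \<in> nodes N\<close> \<open>v \<in> node_vars N n\<close>
proof (induction rule: node_induct)
  case (node n)
  show ?case
  proof (cases "node_label N n")
    case (Lit l)
    then have "v = var_of l"
      using node by (simp add: node_vars_unfold[of n] children_leaf)
    moreover have "v \<in> V"
      using literal_over[OF node.hyps Lit] calculation by (simp add: literals_def)
    ultimately show ?thesis
      using Lit cons
      by (cases l) (auto simp: node_eval.simps[of _ n] distrib_left idem
          consistency_preserving_def mult.commute)
  next
    case Disj
    obtain k where "k \<in> children N n" "v \<in> node_vars N k"
      using node.prems Disj by (auto simp: node_vars_unfold[of n])
    then have "v \<in> node_vars N m" if "m \<in> children N n" for m
      using node.hyps Disj \<open>smooth\<close> that unfolding smooth_def by blast
    with Disj show ?thesis
      by (simp add: node_eval.simps[of _ n] sum_distrib_right node.IH)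
  next
    case Conj
    then obtain m where m: "m \<in> children N n" "v \<in> node_vars N m"
      using node.prems by (auto simp: node_vars_unfold[of n])
    from prod_mult_absorb[where f = "node_eval \<alpha>", OF finite_children m(1) node.IH[OF m]] Conj show ?thesis
      by (simp add: node_eval.simps[of _ n])
  qed (use node in \<open>simp_all add: node_vars_unfold[of n] children_leaf\<close>)
qed

lemma Eval_mult_prod_eq_amc:
  fixes \<alpha> :: "'v literal \<Rightarrow> 'a::{comm_semiring_0, comm_monoid_mult}"
  assumes "finite V"
    and "\<And>a::'a. a * a = a"
    and "consistency_preserving V \<alpha>"
    and "(\<forall>a::'a. a + a = a) \<or> deterministic"
    and "equivalent_to T"
  shows "Eval \<alpha> * (\<Prod>v\<in>V. \<alpha> (Pos v) + \<alpha> (Neg v)) = amc V T \<alpha>"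
proof -
  \<comment> \<open>The product is the total weight of all interpretations; distributing over it
    lets each weight test satisfaction at the root.\<close>
  have "Eval \<alpha> * (\<Prod>v\<in>V. \<alpha> (Pos v) + \<alpha> (Neg v))
      = (\<Sum>I\<in>interpretations V. node_eval \<alpha> (root_node N) * prod \<alpha> I)"
    using \<open>finite V\<close>
    by (simp add: Eval_def sum_distrib_left flip: sum_interpretations_prod)
  also have "\<dots> = (\<Sum>I\<in>interpretations V. if node_sat I (root_node N) then prod \<alpha> I else 0)"
    using assms root_in_nodes by (intro sum.cong node_eval_mult_interpretation) auto
  also have "\<dots> = (\<Sum>I\<in>{I \<in> interpretations V. node_sat I (root_node N)}. prod \<alpha> I)"
    using \<open>finite V\<close> by (simp add: sum.inter_filter finite_interpretations)
  also have "\<dots> = amc V T \<alpha>"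
    using \<open>equivalent_to T\<close> by (simp add: amc_def equivalent_to_def)
  finally show ?thesis .
qed

text \<open>The set \<open>A\<close> is kept general so that induction can remove one variable at a
  time; the case of interest is \<open>A = V\<close>.\<close>

lemma smooth_Eval_mult_prod:
  fixes \<alpha> :: "'v literal \<Rightarrow> 'a::{comm_semiring_0, comm_monoid_mult}"
  assumes "\<And>a::'a. a * a = a" and "consistency_preserving V \<alpha>" and smooth
    and "finite A" and "A \<subseteq> node_vars N (root_node N)"
  shows "Eval \<alpha> * (\<Prod>v\<in>A. \<alpha> (Pos v) + \<alpha> (Neg v)) = Eval \<alpha>"
  using assms(4,5)
proof (induction A)
  case (insert v A)
  then show ?case
    using smooth_node_eval_absorb[OF assms(1-3) root_in_nodes, of v]
    by (simp add: Eval_def flip: mult.assoc)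
qed simp

end

theorem theorem7:
  fixes V :: "'v set"
    and T :: "'v prop_theory"
    and N :: "('n, 'v) circuit"
    and \<alpha> :: "'v literal \<Rightarrow> 'a::{comm_semiring_0, comm_monoid_mult}"
  assumes "finite V"
    and "theory_over V T"
    and "\<And>a::'a. a * a = a"
    and "consistency_preserving V \<alpha>"
    and "nnf_circuit V N"
    and "nnf_circuit.equivalent_to V N T"
    and "(nnf_circuit.smooth N \<and> node_vars N (root_node N) = V \<and> (\<forall>a::'a. a + a = a))
       \<or> (nnf_circuit.deterministic V N \<and> neutral_labeling V \<alpha>)
       \<or> ((\<forall>a::'a. a + a = a) \<and> neutral_labeling V \<alpha>)"
  shows "nnf_circuit.Eval N \<alpha> = amc V T \<alpha>"
proof -
  interpret nnf_circuit V N by fact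
  have "Eval \<alpha> * (\<Prod>v\<in>V. \<alpha> (Pos v) + \<alpha> (Neg v)) = amc V T \<alpha>"
    using assms by (intro Eval_mult_prod_eq_amc) auto
  \<comment> \<open>In the smooth case the root mentions all of \<open>V\<close> and absorbs every
    factor; in the two neutral cases every factor is \<open>1\<close>.\<close>
  moreover have "Eval \<alpha> * (\<Prod>v\<in>V. \<alpha> (Pos v) + \<alpha> (Neg v)) = Eval \<alpha>"
    using assms(7)
  proof (elim disjE)
    assume "smooth \<and> node_vars N (root_node N) = V \<and> (\<forall>a::'a. a + a = a)"
    with assms show ?thesis
      by (intro smooth_Eval_mult_prod) auto
  qed (simp_all add: neutral_labeling_def)
  ultimately show ?thesis by simp
qed

end
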